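(* Let $\ell\ge 1$, let $(\Omega,\mathcal F,P)$ be a probability space, and let $\Gamma_1,\Gamma_2,\ldots\in\mathcal F$ be a sequence of events. Let $\phi(k),\psi(k)$, $k\ge 0$, be the $\phi$- and $\psi$-dependence coefficients (defined in the context) of the family of $\sigma$-algebras generated by the events $\Gamma_n$. Assume that $\sum_{n\ge 0}\phi(n)<\infty$ in the case $\ell=1$, and that $\sum_{n\ge 0}\psi(n)<\infty$ in the case $\ell>1$. Let $q_1,\ldots,q_\ell$ be functions defined on the integers $n\ge 0$, taking nonnegative integer values, with $q_i(n)\ge 1$ for all $n\ge 1$ and all $i$, and suppose that there is a constant $K>0$ such that for any $i\ne j$, $1\le i,j\le \ell$, and every integer $k$, the number of integers $n\ge 0$ satisfying at least one of the equations $$q_i(n)-q_j(n)=k\quad\text{and}\quad q_i(n)=k$$ does not exceed $K$ (when $\ell=1$ the requirement is only that for every integer $k$ the number of $n\ge 0$ with $q_1(n)=k$ does not exceed $K$). Set $$S_N=\sum_{n=1}^N\prod_{i=1}^\ell \mathbb I_{\Gamma_{q_i(n)}},\qquad \mathcal E_N=\sum_{n=1}^N\prod_{i=1}^\ell P(\Gamma_{q_i(n)}),$$ and suppose that $\mathcal E_N\to\infty$ as $N\to\infty$. Then, with probability one, $$\lim_{N\to\infty}\frac{S_N}{\mathcal E_N}=1.$$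
   Context: $\mathbb I_\Gamma$ denotes the indicator of the event $\Gamma$. For two sub-$\sigma$-algebras $\mathcal G,\mathcal H\subset\mathcal F$ set $$\phi(\mathcal G,\mathcal H)=\sup\Big\{\Big|\frac{P(\Gamma\cap\Delta)}{P(\Gamma)}-P(\Delta)\Big|:\ \Gamma\in\mathcal G,\ \Delta\in\mathcal H,\ P(\Gamma)\ne 0\Big\},$$ $$\psi(\mathcal G,\mathcal H)=\sup\Big\{\Big|\frac{P(\Gamma\cap\Delta)}{P(\Gamma)P(\Delta)}-1\Big|:\ \Gamma\in\mathcal G,\ \Delta\in\mathcal H,\ P(\Gamma)P(\Delta)\ne 0\Big\}\in[0,\infty].$$ $\sigma$-algebras: for $1\le m\le n<\infty$, $\mathcal F_{mn}$ is the $\sigma$-algebra generated by $\Gamma_m,\Gamma_{m+1},\ldots,\Gamma_n$; $\mathcal F_{mn}=\mathcal F_{1n}$ for $-\infty\le m\le 0$ and $n\ge 1$; $\mathcal F_{mn}=\{\emptyset,\Omega\}$ for $m,n\le 0$; and $\mathcal F_{m,\infty}=\sigma\{\Gamma_m,\Gamma_{m+1},\ldots\}$ for $m\ge1$. Dependence coefficients: for $k=0,1,2,\ldots$, $$\phi(k)=\sup_m\phi(\mathcal F_{-\infty,m},\mathcal F_{m+k,\infty}),\qquad \psi(k)=\sup_m\psi(\mathcal F_{-\infty,m},\mathcal F_{m+k,\infty}),$$ the suprema being over integers $m$ (terms with $m\le 0$ equal $0$ because $\mathcal F_{-\infty,m}$ is then trivial, so one may take $m\ge 1$). *)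

theory Defs
  imports "HOL-Probability.Probability" "HOL-Library.Extended"
begin

text \<open>The arguments \<open>\<G>\<close>, \<open>\<H>\<close> are sub-\<open>\<sigma>\<close>-algebras, given as the collections of
  their sets. The values lie in \<open>[0, \<infinity>]\<close>.\<close>

definition phi_dep :: "'a measure \<Rightarrow> 'a set set \<Rightarrow> 'a set set \<Rightarrow> ennreal" where
  "phi_dep M \<G> \<H> =
     Sup {ennreal \<bar>measure M (A \<inter> B) / measure M A - measure M B\<bar> | A B.
            A \<in> \<G> \<and> B \<in> \<H> \<and> measure M A \<noteq> 0}"

definition psi_dep :: "'a measure \<Rightarrow> 'a set set \<Rightarrow> 'a set set \<Rightarrow> ennreal" where
  "psi_dep M \<G> \<H> =
     Sup {ennreal \<bar>measure M (A \<inter> B) / (measure M A * measure M B) - 1\<bar> | A B.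
            A \<in> \<G> \<and> B \<in> \<H> \<and> measure M A * measure M B \<noteq> 0}"

text \<open>The \<open>\<sigma>\<close>-algebra generated by the \<open>\<Gamma> i\<close> with \<open>i \<ge> 1\<close> and \<open>m \<le> i \<le> n\<close>, where \<open>m\<close> and
  \<open>n\<close> are integers, \<open>-\<infinity>\<close> (\<open>Minf\<close>) or \<open>\<infinity>\<close> (\<open>Pinf\<close>). Lower bounds below \<open>1\<close> thus act as \<open>1\<close>,
  and the \<open>\<sigma>\<close>-algebra is trivial for \<open>n \<le> 0\<close>. The event \<open>\<Gamma> 0\<close> is never used.\<close>

definition event_sigma ::
    "'a measure \<Rightarrow> (nat \<Rightarrow> 'a set) \<Rightarrow> int extended \<Rightarrow> int extended \<Rightarrow> 'a set set" where
  "event_sigma M \<Gamma> m n =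
     sigma_sets (space M) {\<Gamma> i | i. 1 \<le> i \<and> m \<le> Fin (int i) \<and> Fin (int i) \<le> n}"

definition phi_mixing :: "'a measure \<Rightarrow> (nat \<Rightarrow> 'a set) \<Rightarrow> nat \<Rightarrow> ennreal" where
  "phi_mixing M \<Gamma> k =
     (SUP m::int. phi_dep M (event_sigma M \<Gamma> Minf (Fin m)) (event_sigma M \<Gamma> (Fin (m + int k)) Pinf))"

definition psi_mixing :: "'a measure \<Rightarrow> (nat \<Rightarrow> 'a set) \<Rightarrow> nat \<Rightarrow> ennreal" where
  "psi_mixing M \<Gamma> k =
     (SUP m::int. psi_dep M (event_sigma M \<Gamma> Minf (Fin m)) (event_sigma M \<Gamma> (Fin (m + int k)) Pinf))"

definition hit_sum :: "(nat \<Rightarrow> 'a set) \<Rightarrow> (nat \<Rightarrow> nat \<Rightarrow> nat) \<Rightarrow> nat \<Rightarrow> nat \<Rightarrow> 'a \<Rightarrow> real" where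
  "hit_sum \<Gamma> q l N \<omega> = (\<Sum>n=1..N. \<Prod>i=1..l. indicator (\<Gamma> (q i n)) \<omega>)"

text \<open>In general this is not the expectation of \<open>hit_sum\<close>: the probabilities are multiplied
  although the events may be dependent.\<close>

definition prob_sum ::
    "'a measure \<Rightarrow> (nat \<Rightarrow> 'a set) \<Rightarrow> (nat \<Rightarrow> nat \<Rightarrow> nat) \<Rightarrow> nat \<Rightarrow> nat \<Rightarrow> real" where
  "prob_sum M \<Gamma> q l N = (\<Sum>n=1..N. \<Prod>i=1..l. measure M (\<Gamma> (q i n)))"

end

theory Submission
  imports Defs "HOL-Real_Asymp.Real_Asymp"
begin

text \<open>
  The mean square distance of \<open>S\<^sub>N\<close> and \<open>\<E>\<^sub>N\<close> is at most \<open>C \<E>\<^sub>N\<close>. Along the first times \<open>N\<^sub>k\<close>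
  with \<open>\<E>\<^sub>N \<ge> k\<^sup>2\<close> the mean squares of \<open>S\<^sub>N/\<E>\<^sub>N - 1\<close> are then summable, which gives almost
  sure convergence along \<open>N\<^sub>k\<close>; since both sums are monotone and the increments of \<open>\<E>\<^sub>N\<close> are at most
  \<open>1\<close>, the ratio cannot oscillate between consecutive \<open>N\<^sub>k\<close>.

  For the mean square bound with \<open>\<ell> > 1\<close>, splitting off events in decreasing order of their indices
  shows that the probability of an intersection differs from the product of the probabilities by at
  most that product times a constant times the sum of \<open>\<psi>\<close> over all index differences. Every
  difference, within one time \<open>n\<close> or between two times \<open>n\<close> and \<open>m\<close>, takes each value a bounded
  number of times as one of the times varies, so summing \<open>\<psi>\<close> over that time costs only
  a constant and the other time contributes \<open>\<E>\<^sub>N\<close>.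
\<close>

section \<open>Ratios of monotone sequences: from a subsequence to all indices\<close>

text \<open>With \<open>k\<close> the integer part of \<open>sqrt (e n)\<close>, the index
  \<open>n\<close> lies between \<open>f k\<close> and \<open>f (Suc k)\<close>. Monotonicity then
  traps \<open>s n / e n\<close> between the ratios at these two indices, up to the factors
  \<open>k^2 / (k+1)^2\<close> and \<open>((k+1)^2 + 1) / k^2\<close>, which tend to 1.\<close>

lemma tendsto_ratio_from_subsequence:
  fixes s e :: "nat \<Rightarrow> real" and f :: "nat \<Rightarrow> nat"
  assumes s: "mono s" "\<And>n. 0 \<le> s n" and e: "mono e" "\<And>n. 0 \<le> e n"
    and lim: "filterlim e at_top sequentially"
    and f_lower: "\<And>k. (real k)\<^sup>2 \<le> e (f k)"
    and f_upper: "\<And>k. e (f k) \<le> (real k)\<^sup>2 + 1"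
    and f_least: "\<And>k n. (real k)\<^sup>2 \<le> e n \<Longrightarrow> f k \<le> n"
    and sub: "(\<lambda>k. s (f k) / e (f k)) \<longlonglongrightarrow> 1"
  shows "(\<lambda>n. s n / e n) \<longlonglongrightarrow> 1"
proof -
  define k where "k n = nat \<lfloor>sqrt (e n)\<rfloor>" for n
  have "filterlim (\<lambda>n. sqrt (e n)) at_top sequentially"
    using lim sqrt_at_top filterlim_compose by blast
  then have klim: "filterlim k sequentially sequentially"
    unfolding k_def
    by (intro filterlim_compose[OF filterlim_nat_sequentially]
        filterlim_compose[OF filterlim_floor_sequentially])
  have k_le: "(real (k n))\<^sup>2 \<le> e n" for n
  proof -
    have "real (k n) \<le> sqrt (e n)" unfolding k_def using e(2)[of n] by simp
    then have "(real (k n))\<^sup>2 \<le> (sqrt (e n))\<^sup>2" by (intro power_mono) auto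
    then show ?thesis using e(2)[of n] by simp
  qed
  have k_gt: "e n \<le> (real (Suc (k n)))\<^sup>2" for n
  proof -
    have "sqrt (e n) \<le> real (Suc (k n))" unfolding k_def using e(2)[of n] by (simp; linarith)
    then have "(sqrt (e n))\<^sup>2 \<le> (real (Suc (k n)))\<^sup>2" using e(2)[of n] by (intro power_mono) auto
    then show ?thesis using e(2)[of n] by simp
  qed
  have f_le: "f (k n) \<le> n" for n using f_least k_le by blast
  have s_up: "s n \<le> s (f (Suc (k n)))" for n
  proof (cases "f (Suc (k n)) \<le> n")
    case False
    then show ?thesis using s(1) by (simp add: monoD)
  next
    \<comment> \<open>Contradictory case: \<open>e n\<close> would reach \<open>(k n + 1)^2\<close>,
      although \<open>k n\<close> is the integer part of its root.\<close>
    case True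
    have *: "(real (Suc (k n)))\<^sup>2 \<le> e n"
      using f_lower[of "Suc (k n)"] monoD[OF e(1) True] by linarith
    have "\<not> (real (Suc (k n)) \<le> sqrt (e n))"
      unfolding k_def using e(2)[of n] by (simp; linarith)
    moreover have "real (Suc (k n)) \<le> sqrt (e n)" using * by (rule real_le_rsqrt)
    ultimately show ?thesis by blast
  qed
  define r where "r k = s (f k) / e (f k)" for k
  have r: "r \<longlonglongrightarrow> 1" using sub unfolding r_def .
  have lo: "(\<lambda>k. r k * (real k)\<^sup>2 / (real (Suc k))\<^sup>2) \<longlonglongrightarrow> 1"
  proof -
    have "(\<lambda>k. (real k)\<^sup>2 / (real (Suc k))\<^sup>2) \<longlonglongrightarrow> 1" by real_asymp
    from tendsto_mult[OF r this] show ?thesis by simp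
  qed
  have hi: "(\<lambda>k. r (Suc k) * ((real (Suc k))\<^sup>2 + 1) / (real k)\<^sup>2) \<longlonglongrightarrow> 1"
  proof -
    have "(\<lambda>k. ((real (Suc k))\<^sup>2 + 1) / (real k)\<^sup>2) \<longlonglongrightarrow> 1" by real_asymp
    from tendsto_mult[OF LIMSEQ_Suc[OF r] this] show ?thesis by simp
  qed
  \<comment> \<open>The upper bound divides by the square of \<open>k n\<close>; the lower one needs
    \<open>e n\<close> and \<open>e (f (k n))\<close> to be positive.\<close>
  have kpos: "eventually (\<lambda>n. k n \<ge> 1) sequentially"
    using klim by (simp add: filterlim_at_top)
  show ?thesis
  proof (rule tendsto_sandwich)
    show "eventually (\<lambda>n. r (k n) * (real (k n))\<^sup>2 / (real (Suc (k n)))\<^sup>2 \<le> s n / e n) sequentially"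
      using kpos
    proof eventually_elim
      case (elim n)
      have en: "e n > 0" using k_le[of n] elim
        by (smt (verit) of_nat_le_iff of_nat_1 power_le_one_iff zero_less_power)
      have ef: "e (f (k n)) > 0" using f_lower[of "k n"] elim
        by (smt (verit) of_nat_le_iff of_nat_1 zero_less_power)
      have "r (k n) * (real (k n))\<^sup>2 \<le> s (f (k n))"
        unfolding r_def using f_lower[of "k n"] s(2)[of "f (k n)"] ef
        by (simp add: divide_le_eq mult_left_mono)
      also have "\<dots> \<le> s n" using s(1) f_le by (simp add: monoD)
      finally have "r (k n) * (real (k n))\<^sup>2 / (real (Suc (k n)))\<^sup>2 \<le> s n / (real (Suc (k n)))\<^sup>2"
        by (rule divide_right_mono) simp
      also have "\<dots> \<le> s n / e n"
        using k_gt[of n] en s(2)[of n] by (intro divide_left_mono) auto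
      finally show ?case .
    qed
    show "eventually (\<lambda>n. s n / e n \<le> r (Suc (k n)) * ((real (Suc (k n)))\<^sup>2 + 1) / (real (k n))\<^sup>2) sequentially"
      using kpos
    proof eventually_elim
      case (elim n)
      have kp: "(real (k n))\<^sup>2 > 0" using elim by simp
      have ef: "e (f (Suc (k n))) > 0"
        using f_lower[of "Suc (k n)"] by (smt (verit) of_nat_0_less_iff zero_less_Suc zero_less_power)
      have "s n / e n \<le> s n / (real (k n))\<^sup>2"
        using k_le[of n] kp s(2)[of n] by (intro divide_left_mono mult_pos_pos) linarith+
      also have "\<dots> \<le> s (f (Suc (k n))) / (real (k n))\<^sup>2"
        using s_up by (intro divide_right_mono) auto
      also have "s (f (Suc (k n))) = r (Suc (k n)) * e (f (Suc (k n)))"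
        unfolding r_def using ef by simp
      also have "r (Suc (k n)) * e (f (Suc (k n))) / (real (k n))\<^sup>2
          \<le> r (Suc (k n)) * ((real (Suc (k n)))\<^sup>2 + 1) / (real (k n))\<^sup>2"
        using f_upper[of "Suc (k n)"] s(2) e(2) unfolding r_def
        by (intro divide_right_mono mult_left_mono) auto
      finally show ?case .
    qed
    show "(\<lambda>n. r (k n) * (real (k n))\<^sup>2 / (real (Suc (k n)))\<^sup>2) \<longlonglongrightarrow> 1"
      using filterlim_compose[OF lo klim] .
    show "(\<lambda>n. r (Suc (k n)) * ((real (Suc (k n)))\<^sup>2 + 1) / (real (k n))\<^sup>2) \<longlonglongrightarrow> 1"
      using filterlim_compose[OF hi klim] .
  qed
qed

section \<open>Second moments and almost sure convergence\<close>

text \<open>The centring numbers \<open>p n\<close> are arbitrary, because a product of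
  probabilities need not be the probability of the intersection. Hence four terms appear in place of
  a covariance.\<close>

lemma (in prob_space) second_moment_indicator_sum:
  fixes p :: "'i \<Rightarrow> real"
  assumes "finite I" and A: "\<And>n. n \<in> I \<Longrightarrow> A n \<in> events"
  shows "integrable M (\<lambda>\<omega>. ((\<Sum>n\<in>I. indicator (A n) \<omega>) - (\<Sum>n\<in>I. p n))\<^sup>2)"
    and "expectation (\<lambda>\<omega>. ((\<Sum>n\<in>I. indicator (A n) \<omega>) - (\<Sum>n\<in>I. p n))\<^sup>2) =
      (\<Sum>n\<in>I. \<Sum>m\<in>I. prob (A n \<inter> A m) - p n * prob (A m) - p m * prob (A n) + p n * p m)"
proof -
  have eq: "((\<Sum>n\<in>I. indicator (A n) \<omega>) - (\<Sum>n\<in>I. p n))\<^sup>2 =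
      (\<Sum>n\<in>I. \<Sum>m\<in>I. indicator (A n \<inter> A m) \<omega> - p n * indicator (A m) \<omega>
         - p m * indicator (A n) \<omega> + p n * p m)" for \<omega>
    unfolding sum_subtractf[symmetric] power2_eq_square sum_product
    by (intro sum.cong refl) (auto simp: indicator_inter_arith algebra_simps)
  have int: "integrable M (indicator (A n) :: _ \<Rightarrow> real)" if "n \<in> I" for n
    using A[OF that] by (intro integrable_real_indicator) (auto simp: emeasure_eq_measure)
  have int2: "integrable M (indicator (A n \<inter> A m) :: _ \<Rightarrow> real)" if "n \<in> I" "m \<in> I" for n m
    using A that by (intro integrable_real_indicator) (auto simp: emeasure_eq_measure)
  show "integrable M (\<lambda>\<omega>. ((\<Sum>n\<in>I. indicator (A n) \<omega>) - (\<Sum>n\<in>I. p n))\<^sup>2)"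
    unfolding eq by (intro Bochner_Integration.integrable_sum Bochner_Integration.integrable_add
        Bochner_Integration.integrable_diff integrable_mult_right int int2) auto
  have "expectation (\<lambda>\<omega>. ((\<Sum>n\<in>I. indicator (A n) \<omega>) - (\<Sum>n\<in>I. p n))\<^sup>2) =
      (\<Sum>n\<in>I. \<Sum>m\<in>I. expectation (\<lambda>\<omega>. indicator (A n \<inter> A m) \<omega> - p n * indicator (A m) \<omega>
         - p m * indicator (A n) \<omega> + p n * p m))"
    unfolding eq
    by (subst Bochner_Integration.integral_sum;
        (intro sum.cong refl Bochner_Integration.integral_sum)?;
        intro Bochner_Integration.integrable_sum Bochner_Integration.integrable_add
        Bochner_Integration.integrable_diff integrable_mult_right int int2) auto
  also have "\<dots> = (\<Sum>n\<in>I. \<Sum>m\<in>I. prob (A n \<inter> A m) - p n * prob (A m) - p m * prob (A n) + p n * p m)"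
  proof (intro sum.cong refl)
    fix n m assume nm: "n \<in> I" "m \<in> I"
    \<comment> \<open>Expectations of indicators come out as probabilities of sets cut with
      \<open>space M\<close>; these equations remove the cut.\<close>
    have sub: "A n \<inter> space M = A n" "A m \<inter> space M = A m" 
      using sets.sets_into_space[OF A[OF nm(1)]] sets.sets_into_space[OF A[OF nm(2)]] by auto
    then have sub2: "A n \<inter> A m \<inter> space M = A n \<inter> A m" by auto
    have "expectation (\<lambda>\<omega>. indicator (A n \<inter> A m) \<omega> - p n * indicator (A m) \<omega>
         - p m * indicator (A n) \<omega> + p n * p m) =
      expectation (indicator (A n \<inter> A m)) - p n * expectation (indicator (A m))
       - p m * expectation (indicator (A n)) + p n * p m"
      using int[OF nm(1)] int[OF nm(2)] int2[OF nm] by (simp add: prob_space)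
    then show "expectation (\<lambda>\<omega>. indicator (A n \<inter> A m) \<omega> - p n * indicator (A m) \<omega>
         - p m * indicator (A n) \<omega> + p n * p m) =
       prob (A n \<inter> A m) - p n * prob (A m) - p m * prob (A n) + p n * p m"
      by (simp add: sub sub2)
  qed
  finally show "expectation (\<lambda>\<omega>. ((\<Sum>n\<in>I. indicator (A n) \<omega>) - (\<Sum>n\<in>I. p n))\<^sup>2) =
      (\<Sum>n\<in>I. \<Sum>m\<in>I. prob (A n \<inter> A m) - p n * prob (A m) - p m * prob (A n) + p n * p m)" .
qed

text \<open>Exchanging sum and integral shows that the sum of all squares has finite expectation. It
  is therefore almost surely finite, so its terms tend to 0.\<close>

lemma (in prob_space) AE_tendsto_0_of_summable_second_moments:
  fixes Y :: "nat \<Rightarrow> 'a \<Rightarrow> real"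
  assumes int: "\<And>k. integrable M (\<lambda>\<omega>. (Y k \<omega>)\<^sup>2)"
    and le: "\<And>k. expectation (\<lambda>\<omega>. (Y k \<omega>)\<^sup>2) \<le> b k" and b: "summable b"
  shows "AE \<omega> in M. (\<lambda>k. Y k \<omega>) \<longlonglongrightarrow> 0"
proof -
  have b0: "0 \<le> b k" for k
    by (rule order_trans[OF Bochner_Integration.integral_nonneg le]) simp
  have meas[measurable]: "(\<lambda>\<omega>. (Y k \<omega>)\<^sup>2) \<in> borel_measurable M" for k
    using int by blast
  have "(\<integral>\<^sup>+\<omega>. (\<Sum>k. ennreal ((Y k \<omega>)\<^sup>2)) \<partial>M) = (\<Sum>k. \<integral>\<^sup>+\<omega>. ennreal ((Y k \<omega>)\<^sup>2) \<partial>M)"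
    by (rule nn_integral_suminf) measurable
  also have "\<dots> = (\<Sum>k. ennreal (expectation (\<lambda>\<omega>. (Y k \<omega>)\<^sup>2)))"
    using int by (subst nn_integral_eq_integral) auto
  also have "\<dots> \<le> (\<Sum>k. ennreal (b k))"
    using le by (intro suminf_le) (auto intro: ennreal_leI)
  also have "\<dots> = ennreal (\<Sum>k. b k)" using b b0 by (intro suminf_ennreal2) auto
  also have "\<dots> < \<infinity>" by simp
  finally have "AE \<omega> in M. (\<Sum>k. ennreal ((Y k \<omega>)\<^sup>2)) \<noteq> \<infinity>"
    by (intro nn_integral_noteq_infinite) auto
  then show ?thesis
  proof eventually_elim
    case (elim \<omega>)
    then have "summable (\<lambda>k. (Y k \<omega>)\<^sup>2)"
      by (intro summable_suminf_not_top) (auto simp: top_ennreal_def)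
    then have "(\<lambda>k. (Y k \<omega>)\<^sup>2) \<longlonglongrightarrow> 0" by (rule summable_LIMSEQ_zero)
    then have "(\<lambda>k. sqrt ((Y k \<omega>)\<^sup>2)) \<longlonglongrightarrow> sqrt 0" by (rule tendsto_real_sqrt)
    then show ?case by (simp add: tendsto_rabs_zero_iff)
  qed
qed

lemma (in prob_space) AE_indicator_sum_ratio_tendsto_1:
  fixes A :: "nat \<Rightarrow> 'a set" and p :: "nat \<Rightarrow> real"
  assumes A: "\<And>n. n \<ge> 1 \<Longrightarrow> A n \<in> events"
    and p: "\<And>n. 0 \<le> p n" "\<And>n. p n \<le> 1"
    and lim: "filterlim (\<lambda>N. \<Sum>n=1..N. p n) at_top sequentially"
    and bound: "\<And>N. (\<Sum>n=1..N. \<Sum>m=1..N. prob (A n \<inter> A m) - p n * prob (A m) - p m * prob (A n) + p n * p m)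
        \<le> C * (\<Sum>n=1..N. p n)"
  shows "AE \<omega> in M. (\<lambda>N. (\<Sum>n=1..N. indicator (A n) \<omega>) / (\<Sum>n=1..N. p n)) \<longlonglongrightarrow> 1"
proof -
  define e where "e N = (\<Sum>n=1..N. p n)" for N
  define s where "s N \<omega> = (\<Sum>n=1..N. indicator (A n) \<omega> :: real)" for N \<omega>
  \<comment> \<open>Squares serve two ends: their reciprocals are summable, and the ratio of
    consecutive ones tends to 1.\<close>
  define f where "f k = (LEAST n. (real k)\<^sup>2 \<le> e n)" for k
  have e_mono: "mono e" unfolding e_def using p by (intro monoI sum_mono2) auto
  have e0: "0 \<le> e n" for n unfolding e_def using p by (intro sum_nonneg) auto
  have lim_e: "filterlim e at_top sequentially" using lim unfolding e_def .
  have ex: "\<exists>n. (real k)\<^sup>2 \<le> e n" for k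
    using lim_e by (auto simp: filterlim_at_top eventually_sequentially)
  have f_lower: "(real k)\<^sup>2 \<le> e (f k)" for k
    unfolding f_def using ex by (rule LeastI_ex)
  have f_least: "f k \<le> n" if "(real k)\<^sup>2 \<le> e n" for k n
    unfolding f_def using that by (rule Least_le)
  \<comment> \<open>By minimality the value just before \<open>f k\<close> lies below
    \<open>k^2\<close>, and one step adds at most 1.\<close>
  have f_upper: "e (f k) \<le> (real k)\<^sup>2 + 1" for k
  proof (cases "f k")
    case 0
    then show ?thesis by (simp add: e_def)
  next
    case (Suc n)
    then have "\<not> (real k)\<^sup>2 \<le> e n" using f_least[of k n] by auto
    moreover have "e (Suc n) = e n + p (Suc n)" by (simp add: e_def)
    ultimately show ?thesis using Suc p(2)[of "Suc n"] by simp
  qed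
  \<comment> \<open>The shift to \<open>Suc k\<close> avoids \<open>f 0 = 0\<close>, where
    \<open>e\<close> vanishes.\<close>
  have "AE \<omega> in M. (\<lambda>k. (s (f (Suc k)) \<omega> - e (f (Suc k))) / e (f (Suc k))) \<longlonglongrightarrow> 0"
  proof (rule AE_tendsto_0_of_summable_second_moments)
    fix k
    let ?n = "f (Suc k)"
    have pos: "e ?n > 0"
      using f_lower[of "Suc k"] by (smt (verit) of_nat_0_less_iff zero_less_Suc zero_less_power)
    have A': "\<And>n. n \<in> {1..?n} \<Longrightarrow> A n \<in> events" using A by auto
    note sm = second_moment_indicator_sum[of "{1..?n}" A p, OF finite_atLeastAtMost A',
        folded s_def e_def]
    show "integrable M (\<lambda>\<omega>. ((s ?n \<omega> - e ?n) / e ?n)\<^sup>2)"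
      unfolding power_divide using sm(1) by (intro integrable_divide) simp
    have "expectation (\<lambda>\<omega>. ((s ?n \<omega> - e ?n) / e ?n)\<^sup>2) =
        expectation (\<lambda>\<omega>. (s ?n \<omega> - e ?n)\<^sup>2) / (e ?n)\<^sup>2"
      unfolding power_divide by simp
    also have "\<dots> \<le> C * e ?n / (e ?n)\<^sup>2"
      using bound[of ?n] sm(2) by (intro divide_right_mono) (auto simp: e_def)
    \<comment> \<open>\<open>C\<close> may have either sign; replacing \<open>e ?n\<close> by its
      lower bound in the denominator requires a nonnegative numerator.\<close>
    also have "\<dots> \<le> \<bar>C\<bar> * e ?n / (e ?n)\<^sup>2"
      using pos by (intro divide_right_mono mult_right_mono) auto
    also have "\<dots> = \<bar>C\<bar> / e ?n" using pos by (simp add: power2_eq_square)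
    also have "\<dots> \<le> \<bar>C\<bar> / (real (Suc k))\<^sup>2"
      using f_lower[of "Suc k"] pos by (intro divide_left_mono mult_pos_pos) auto
    finally show "expectation (\<lambda>\<omega>. ((s ?n \<omega> - e ?n) / e ?n)\<^sup>2) \<le> \<bar>C\<bar> * inverse ((real (Suc k))\<^sup>2)"
      by (simp add: divide_inverse)
  next
    show "summable (\<lambda>k. \<bar>C\<bar> * inverse ((real (Suc k))\<^sup>2))"
      using inverse_power_summable[of 2, where 'a=real]
      by (intro summable_mult) (simp add: summable_Suc_iff[of "\<lambda>k. inverse ((real k)\<^sup>2)"] del: of_nat_Suc)
  qed
  then show ?thesis
  proof eventually_elim
    case (elim \<omega>)
    have "(\<lambda>k. (s (f (Suc k)) \<omega> - e (f (Suc k))) / e (f (Suc k)) + 1) \<longlonglongrightarrow> 0 + 1"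
      using elim by (intro tendsto_add) auto
    moreover have "(s (f (Suc k)) \<omega> - e (f (Suc k))) / e (f (Suc k)) + 1 = s (f (Suc k)) \<omega> / e (f (Suc k))" for k
    proof -
      have "e (f (Suc k)) > 0"
        using f_lower[of "Suc k"] by (smt (verit) of_nat_0_less_iff zero_less_Suc zero_less_power)
      then show ?thesis by (simp add: diff_divide_distrib)
    qed
    ultimately have "(\<lambda>k. s (f (Suc k)) \<omega> / e (f (Suc k))) \<longlonglongrightarrow> 1" by simp
    then have sub: "(\<lambda>k. s (f k) \<omega> / e (f k)) \<longlonglongrightarrow> 1"
      by (rule LIMSEQ_imp_Suc)
    have "(\<lambda>N. s N \<omega> / e N) \<longlonglongrightarrow> 1"
    proof (rule tendsto_ratio_from_subsequence[OF _ _ e_mono e0 lim_e f_lower f_upper f_least sub])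
      show "mono (\<lambda>N. s N \<omega>)" unfolding s_def by (intro monoI sum_mono2) auto
      show "0 \<le> s n \<omega>" for n unfolding s_def by (intro sum_nonneg) auto
    qed
    then show ?case unfolding s_def e_def .
  qed
qed

section \<open>Summing coefficients over index differences\<close>

lemma summable_enn2real:
  fixes f :: "nat \<Rightarrow> ennreal"
  assumes "(\<Sum>k. f k) < top"
  shows "f k = ennreal (enn2real (f k))" and "summable (\<lambda>k. enn2real (f k))"
proof -
  have fin: "f k < top" for k using ennreal_suminf_lessD[OF assms] .
  show eq: "f k = ennreal (enn2real (f k))" for k using fin[of k] by simp
  show "summable (\<lambda>k. enn2real (f k))"
    using assms eq by (intro summable_suminf_not_top) auto
qed

text \<open>Grouping by the value of \<open>\<bar>f n\<bar>\<close>, each \<open>k\<close> comes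
  only from the two fibres over \<open>k\<close> and \<open>- k\<close>, hence from at most
  \<open>2 * K\<close> indices. Through this lemma the counting condition on the \<open>q i\<close>
  enters.\<close>

lemma sum_abs_le_suminf_of_fibres:
  fixes g :: "nat \<Rightarrow> real" and f :: "'b \<Rightarrow> int"
  assumes g: "\<And>k. 0 \<le> g k" "summable g" and "finite S"
    and card: "\<And>k. real (card {n \<in> S. f n = k}) \<le> K"
  shows "(\<Sum>n\<in>S. g (nat \<bar>f n\<bar>)) \<le> 2 * K * suminf g"
proof -
  let ?h = "\<lambda>n. nat \<bar>f n\<bar>"
  have "(\<Sum>n\<in>S. g (?h n)) = (\<Sum>k\<in>?h ` S. \<Sum>n | n \<in> S \<and> ?h n = k. g (?h n))"
    using \<open>finite S\<close> by (rule sum.image_gen)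
  also have "\<dots> = (\<Sum>k\<in>?h ` S. real (card {n \<in> S. ?h n = k}) * g k)"
    by (intro sum.cong refl) simp
  also have "\<dots> \<le> (\<Sum>k\<in>?h ` S. 2 * K * g k)"
  proof (intro sum_mono mult_right_mono g)
    fix k
    have "{n \<in> S. ?h n = k} \<subseteq> {n \<in> S. f n = int k} \<union> {n \<in> S. f n = - int k}" by auto
    then have "card {n \<in> S. ?h n = k} \<le> card ({n \<in> S. f n = int k} \<union> {n \<in> S. f n = - int k})"
      using \<open>finite S\<close> by (intro card_mono) auto
    also have "\<dots> \<le> card {n \<in> S. f n = int k} + card {n \<in> S. f n = - int k}" by (rule card_Un_le)
    finally show "real (card {n \<in> S. ?h n = k}) \<le> 2 * K"
      using card[of "int k"] card[of "- int k"] by linarith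
  qed
  also have "\<dots> = 2 * K * (\<Sum>k\<in>?h ` S. g k)" by (rule sum_distrib_left[symmetric])
  also have "\<dots> \<le> 2 * K * suminf g"
  proof (intro mult_left_mono sum_le_suminf g finite_imageI \<open>finite S\<close>)
    \<comment> \<open>\<open>K\<close> is nonnegative because it bounds a cardinality.\<close>
    show "0 \<le> 2 * K" using card[of 0] by linarith
  qed
  finally show ?thesis .
qed

section \<open>Mixing inequalities for events and their intersections\<close>

lemma event_sigma_memI:
  assumes "1 \<le> i" "m \<le> Fin (int i)" "Fin (int i) \<le> n"
  shows "\<Gamma> i \<in> event_sigma M \<Gamma> m n"
  unfolding event_sigma_def using assms by (intro sigma_sets.Basic) blast

lemma event_sigma_Collect_Ball:
  assumes "\<And>n. 1 \<le> n \<Longrightarrow> \<Gamma> n \<in> sets M" and "finite A"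
    and r: "\<And>a. a \<in> A \<Longrightarrow> 1 \<le> r a \<and> int (r a) \<le> m"
  shows "{\<omega> \<in> space M. \<forall>a\<in>A. \<omega> \<in> \<Gamma> (r a)} \<in> event_sigma M \<Gamma> Minf (Fin m)"
proof -
  interpret sigma_algebra "space M" "event_sigma M \<Gamma> Minf (Fin m)"
    unfolding event_sigma_def
    using assms(1)[THEN sets.sets_into_space] by (intro sigma_algebra_sigma_sets) blast
  show ?thesis
  proof (rule sets_Collect_finite_All)
    fix a assume a: "a \<in> A"
    then have "{\<omega> \<in> space M. \<omega> \<in> \<Gamma> (r a)} = \<Gamma> (r a)"
      using assms(1)[of "r a", THEN sets.sets_into_space] r by auto
    then show "{\<omega> \<in> space M. \<omega> \<in> \<Gamma> (r a)} \<in> event_sigma M \<Gamma> Minf (Fin m)"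
      using r[OF a] by (auto intro!: event_sigma_memI)
  qed fact
qed

text \<open>Clearing the denominator in \<open>phi_dep\<close> gives an inequality that survives for
  null \<open>A\<close>, where both sides vanish.\<close>

lemma (in prob_space) phi_mixing_bound:
  assumes fin: "(\<Sum>k. phi_mixing M \<Gamma> k) < top"
    and A: "A \<in> event_sigma M \<Gamma> Minf (Fin m)" and B: "B \<in> event_sigma M \<Gamma> (Fin (m + int k)) Pinf"
    and ev: "A \<in> events" "B \<in> events"
  shows "\<bar>prob (A \<inter> B) - prob A * prob B\<bar> \<le> prob A * enn2real (phi_mixing M \<Gamma> k)"
proof (cases "prob A = 0")
  case True
  then have "prob (A \<inter> B) = 0"
    using finite_measure_mono[of "A \<inter> B" A] ev by (simp add: measure_le_0_iff)
  then show ?thesis using True by simp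
next
  case False
  have "ennreal \<bar>prob (A \<inter> B) / prob A - prob B\<bar>
      \<le> phi_dep M (event_sigma M \<Gamma> Minf (Fin m)) (event_sigma M \<Gamma> (Fin (m + int k)) Pinf)"
    unfolding phi_dep_def using A B False by (intro Sup_upper) blast
  also have "\<dots> \<le> phi_mixing M \<Gamma> k" unfolding phi_mixing_def by (rule SUP_upper) simp
  also have "\<dots> = ennreal (enn2real (phi_mixing M \<Gamma> k))" using summable_enn2real(1)[OF fin] .
  finally have "\<bar>prob (A \<inter> B) / prob A - prob B\<bar> \<le> enn2real (phi_mixing M \<Gamma> k)"
    by (simp add: ennreal_le_iff)
  then have "prob A * \<bar>prob (A \<inter> B) / prob A - prob B\<bar> \<le> prob A * enn2real (phi_mixing M \<Gamma> k)"
    by (intro mult_left_mono) auto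
  moreover have "prob A * \<bar>prob (A \<inter> B) / prob A - prob B\<bar> = \<bar>prob A * (prob (A \<inter> B) / prob A - prob B)\<bar>"
    by (simp add: abs_mult)
  ultimately show ?thesis using False by (simp add: right_diff_distrib)
qed

text \<open>Here the error is relative to the product of both probabilities, which is what allows
  iteration over several factors.\<close>

lemma (in prob_space) psi_mixing_bound:
  assumes fin: "(\<Sum>k. psi_mixing M \<Gamma> k) < top"
    and A: "A \<in> event_sigma M \<Gamma> Minf (Fin m)" and B: "B \<in> event_sigma M \<Gamma> (Fin (m + int k)) Pinf"
    and ev: "A \<in> events" "B \<in> events"
  shows "\<bar>prob (A \<inter> B) - prob A * prob B\<bar> \<le> prob A * prob B * enn2real (psi_mixing M \<Gamma> k)"
proof (cases "prob A * prob B = 0")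
  case True
  then have "prob (A \<inter> B) = 0"
    using finite_measure_mono[of "A \<inter> B" A] finite_measure_mono[of "A \<inter> B" B] ev
    by (auto simp: measure_le_0_iff)
  then show ?thesis using True by auto
next
  case False
  let ?P = "prob A * prob B"
  have "ennreal \<bar>prob (A \<inter> B) / ?P - 1\<bar>
      \<le> psi_dep M (event_sigma M \<Gamma> Minf (Fin m)) (event_sigma M \<Gamma> (Fin (m + int k)) Pinf)"
    unfolding psi_dep_def using A B False by (intro Sup_upper) blast
  also have "\<dots> \<le> psi_mixing M \<Gamma> k" unfolding psi_mixing_def by (rule SUP_upper) simp
  also have "\<dots> = ennreal (enn2real (psi_mixing M \<Gamma> k))" using summable_enn2real(1)[OF fin] .
  finally have "\<bar>prob (A \<inter> B) / ?P - 1\<bar> \<le> enn2real (psi_mixing M \<Gamma> k)"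
    by (simp add: ennreal_le_iff)
  then have "?P * \<bar>prob (A \<inter> B) / ?P - 1\<bar> \<le> ?P * enn2real (psi_mixing M \<Gamma> k)"
    by (intro mult_left_mono) auto
  moreover have "?P * \<bar>prob (A \<inter> B) / ?P - 1\<bar> = \<bar>?P * (prob (A \<inter> B) / ?P - 1)\<bar>"
    by (simp add: abs_mult)
  ultimately show ?thesis using False by (simp add: right_diff_distrib)
qed

text \<open>The coefficient is asymmetric: the error carries the probability of the earlier event.
  Adding both probabilities gives a bound independent of the order; equal indices are covered by gap
  0.\<close>

lemma (in prob_space) phi_mixing_pair_bound:
  assumes ev: "\<And>n. 1 \<le> n \<Longrightarrow> \<Gamma> n \<in> events"
    and fin: "(\<Sum>k. phi_mixing M \<Gamma> k) < top" and "1 \<le> a" "1 \<le> b"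
  shows "\<bar>prob (\<Gamma> a \<inter> \<Gamma> b) - prob (\<Gamma> a) * prob (\<Gamma> b)\<bar>
    \<le> (prob (\<Gamma> a) + prob (\<Gamma> b)) * enn2real (phi_mixing M \<Gamma> (nat \<bar>int a - int b\<bar>))"
  using assms(3,4)
proof (induction a b rule: linorder_wlog)
  case (le a b)
  have "\<bar>prob (\<Gamma> a \<inter> \<Gamma> b) - prob (\<Gamma> a) * prob (\<Gamma> b)\<bar>
      \<le> prob (\<Gamma> a) * enn2real (phi_mixing M \<Gamma> (nat \<bar>int a - int b\<bar>))"
    using le by (intro phi_mixing_bound[OF fin, where m = "int a"] event_sigma_memI ev) auto
  also have "\<dots> \<le> (prob (\<Gamma> a) + prob (\<Gamma> b)) * enn2real (phi_mixing M \<Gamma> (nat \<bar>int a - int b\<bar>))"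
    by (intro mult_right_mono) auto
  finally show ?case .
next
  case (sym a b)
  then show ?case by (simp add: Int_commute mult.commute add.commute abs_minus_commute)
qed

text \<open>Induction adds events by increasing index, so the new event lies in the future of all
  earlier ones, and each addition costs a factor of at most \<open>1 + suminf \<psi>\<close>. Labels
  \<open>a\<close> are kept apart from indices \<open>r a\<close>, so an event may occur repeatedly;
  such repetitions count with gap 0.\<close>

lemma (in prob_space) psi_mixing_product_bound:
  fixes r :: "'i \<Rightarrow> nat" and \<Gamma> :: "nat \<Rightarrow> 'a set"
  defines "\<psi> \<equiv> \<lambda>k. enn2real (psi_mixing M \<Gamma> k)"
  assumes ev: "\<And>n. 1 \<le> n \<Longrightarrow> \<Gamma> n \<in> events"
    and fin: "(\<Sum>k. psi_mixing M \<Gamma> k) < top"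
    and "finite A" and "\<And>a. a \<in> A \<Longrightarrow> 1 \<le> r a"
  shows "\<bar>prob {\<omega> \<in> space M. \<forall>a\<in>A. \<omega> \<in> \<Gamma> (r a)} - (\<Prod>a\<in>A. prob (\<Gamma> (r a)))\<bar>
    \<le> (1 + suminf \<psi>) ^ card A * (\<Prod>a\<in>A. prob (\<Gamma> (r a))) *
       (\<Sum>a\<in>A. \<Sum>b\<in>A. if a = b then 0 else \<psi> (nat \<bar>int (r a) - int (r b)\<bar>))"
  using assms(4,5)
proof (induction A rule: finite_ranking_induct[where f = r])
  case empty
  then show ?case by (simp add: prob_space)
next
  case (insert b A)
  have \<psi>0: "0 \<le> \<psi> k" for k by (simp add: \<psi>_def)
  have sm: "summable \<psi>" unfolding \<psi>_def using summable_enn2real(2)[OF fin] .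
  have \<tau>0: "0 \<le> suminf \<psi>" using sm \<psi>0 by (rule suminf_nonneg)
  let ?C = "1 + suminf \<psi>"
  let ?E = "\<lambda>A. {\<omega> \<in> space M. \<forall>a\<in>A. \<omega> \<in> \<Gamma> (r a)}"
  let ?P = "\<lambda>A. \<Prod>a\<in>A. prob (\<Gamma> (r a))"
  let ?d = "\<lambda>a b. if a = b then 0 else \<psi> (nat \<bar>int (r a) - int (r b)\<bar>)"
  let ?S = "\<lambda>A. \<Sum>a\<in>A. \<Sum>b\<in>A. ?d a b"
  show ?case
  \<comment> \<open>The ranking induction does not supply that \<open>b\<close> is new.\<close>
  proof (cases "b \<in> A")
    case True
    then show ?thesis using insert by (simp add: insert_absorb)
  next
    case bA: False
    have IH: "\<bar>prob (?E A) - ?P A\<bar> \<le> ?C ^ card A * ?P A * ?S A" using insert by simp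
    have rb: "1 \<le> r b" using insert.prems by simp
    have P0: "0 \<le> ?P A" by (intro prod_nonneg) auto
    have S0: "0 \<le> ?S A" by (intro sum_nonneg) (auto simp: \<psi>0)
    have Eins: "?E (insert b A) = ?E A \<inter> \<Gamma> (r b)" 
      using ev[OF rb, THEN sets.sets_into_space] by auto
    have EA: "?E A \<in> events"
    proof (rule sets.sets_Collect_finite_All)
      fix a assume "a \<in> A"
      then have *: "\<Gamma> (r a) \<in> events" using insert.prems ev by simp
      then have "{\<omega> \<in> space M. \<omega> \<in> \<Gamma> (r a)} = \<Gamma> (r a)" using sets.sets_into_space by blast
      then show "{\<omega> \<in> space M. \<omega> \<in> \<Gamma> (r a)} \<in> events" using * by simp
    qed fact
    \<comment> \<open>\<open>\<theta>\<close> is the relative cost of splitting off the new event: 0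
      if there is no earlier one, otherwise \<open>\<psi>\<close> at the gap to the largest earlier
      index. The third condition says that this pair is not yet counted in
      \<open>?S A\<close>.\<close>
    obtain \<theta> where \<theta>: "0 \<le> \<theta>" "\<theta> \<le> suminf \<psi>" "?S A + \<theta> \<le> ?S (insert b A)"
      and step: "\<bar>prob (?E A \<inter> \<Gamma> (r b)) - prob (?E A) * prob (\<Gamma> (r b))\<bar>
          \<le> prob (?E A) * prob (\<Gamma> (r b)) * \<theta>"
    proof (cases "A = {}")
      case True
      have "space M \<inter> \<Gamma> (r b) = \<Gamma> (r b)" using ev[OF rb, THEN sets.sets_into_space] by auto
      then show ?thesis using that[of 0] \<tau>0 True by (simp add: prob_space)
    next
      case False
      obtain c where c: "c \<in> A" "\<And>a. a \<in> A \<Longrightarrow> r a \<le> r c"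
        using Max_in[of "r ` A"] Max_ge[of "r ` A"] insert.hyps(1) False by fastforce
      let ?k = "nat \<bar>int (r b) - int (r c)\<bar>"
      have cb: "r c \<le> r b" using insert.hyps(2) c(1) by blast
      show ?thesis
      proof (rule that[of "\<psi> ?k"])
        show "0 \<le> \<psi> ?k" by (rule \<psi>0)
        show "\<psi> ?k \<le> suminf \<psi>" using sum_le_suminf[OF sm, of "{?k}"] \<psi>0 by simp
        have "?S (insert b A) = ?d b b + (\<Sum>x\<in>A. ?d b x) + (\<Sum>a\<in>A. ?d a b + (\<Sum>x\<in>A. ?d a x))"
          using bA insert.hyps(1) by simp
        moreover have "?d b c \<le> (\<Sum>x\<in>A. ?d b x)"
          using c(1) insert.hyps(1) \<psi>0 by (intro member_le_sum) auto
        moreover have "?S A \<le> (\<Sum>a\<in>A. ?d a b + (\<Sum>x\<in>A. ?d a x))"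
          using \<psi>0 by (intro sum_mono) auto
        moreover have "?d b c = \<psi> ?k" using bA c(1) by auto
        ultimately show "?S A + \<psi> ?k \<le> ?S (insert b A)" by simp
        show "\<bar>prob (?E A \<inter> \<Gamma> (r b)) - prob (?E A) * prob (\<Gamma> (r b))\<bar>
          \<le> prob (?E A) * prob (\<Gamma> (r b)) * \<psi> ?k"
          unfolding \<psi>_def
        proof (rule psi_mixing_bound[OF fin, where m = "int (r c)"])
          show "?E A \<in> event_sigma M \<Gamma> Minf (Fin (int (r c)))"
            using insert.prems c by (intro event_sigma_Collect_Ball ev insert.hyps(1)) auto
          show "\<Gamma> (r b) \<in> event_sigma M \<Gamma> (Fin (int (r c) + int ?k)) Pinf"
            using rb cb by (intro event_sigma_memI) auto
        qed (use EA ev[OF rb] in auto)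
      qed
    qed
    let ?p = "prob (\<Gamma> (r b))"
    have C1: "1 \<le> ?C ^ card A" using \<tau>0 by (intro one_le_power) simp
    have "\<bar>prob (?E A \<inter> \<Gamma> (r b)) - ?p * ?P A\<bar>
        \<le> \<bar>prob (?E A \<inter> \<Gamma> (r b)) - prob (?E A) * ?p\<bar> + \<bar>(prob (?E A) - ?P A) * ?p\<bar>"
      by (simp add: algebra_simps)
    also have "\<dots> \<le> prob (?E A) * ?p * \<theta> + \<bar>prob (?E A) - ?P A\<bar> * ?p"
      using step by (simp add: abs_mult)
    \<comment> \<open>Replacing \<open>prob (?E A)\<close> by the product plus its error leaves only
      quantities controlled by the induction hypothesis.\<close>
    also have "\<dots> \<le> (?P A + \<bar>prob (?E A) - ?P A\<bar>) * ?p * \<theta> + \<bar>prob (?E A) - ?P A\<bar> * ?p"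
      using \<theta>(1) by (intro add_right_mono mult_right_mono) auto
    also have "\<dots> = ?p * (?P A * \<theta> + \<bar>prob (?E A) - ?P A\<bar> * (1 + \<theta>))"
      by (simp add: algebra_simps)
    also have "\<dots> \<le> ?p * (?P A * \<theta> + ?C ^ card A * ?P A * ?S A * ?C)"
    proof (intro mult_left_mono add_left_mono)
      show "\<bar>prob (?E A) - ?P A\<bar> * (1 + \<theta>) \<le> ?C ^ card A * ?P A * ?S A * ?C"
        using IH \<theta> by (intro mult_mono) auto
    qed simp
    \<comment> \<open>The first summand is enlarged by a factor of at least 1, so that both share
      \<open>?C ^ Suc (card A)\<close> and combine to \<open>?S A + \<theta>\<close>.\<close>
    also have "\<dots> \<le> ?p * (?C ^ Suc (card A) * (?P A * \<theta>) + ?C ^ card A * ?P A * ?S A * ?C)"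
    proof (intro mult_left_mono add_right_mono)
      have "1 * (?P A * \<theta>) \<le> ?C ^ Suc (card A) * (?P A * \<theta>)"
        using \<tau>0 P0 \<theta>(1) by (intro mult_right_mono one_le_power) auto
      then show "?P A * \<theta> \<le> ?C ^ Suc (card A) * (?P A * \<theta>)" by simp
    qed simp
    also have "\<dots> = ?C ^ Suc (card A) * (?p * ?P A) * (?S A + \<theta>)"
      by (simp add: algebra_simps)
    also have "\<dots> \<le> ?C ^ Suc (card A) * (?p * ?P A) * ?S (insert b A)"
      using \<theta>(3) \<tau>0 P0 by (intro mult_left_mono mult_nonneg_nonneg) auto
    finally show ?thesis
      using bA insert.hyps(1) unfolding Eins by simp
  qed
qed

section \<open>Mean square bounds for one and for several factors\<close>

text \<open>For a fixed time, the coefficients over all gaps to the other times sum to at most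
  \<open>2 * K * suminf \<phi>\<close>. The remaining factor 2 arises because either time may carry
  the probability.\<close>

lemma (in prob_space) phi_covariance_sum_bound:
  fixes r :: "nat \<Rightarrow> nat" and \<Gamma> :: "nat \<Rightarrow> 'a set" and I :: "nat set"
  defines "\<phi> \<equiv> \<lambda>k. enn2real (phi_mixing M \<Gamma> k)"
  assumes ev: "\<And>n. 1 \<le> n \<Longrightarrow> \<Gamma> n \<in> events"
    and fin: "(\<Sum>k. phi_mixing M \<Gamma> k) < top"
    and "finite I" and r: "\<And>n. n \<in> I \<Longrightarrow> 1 \<le> r n"
    and card: "\<And>k::int. real (card {n \<in> I. int (r n) = k}) \<le> K"
  shows "(\<Sum>n\<in>I. \<Sum>m\<in>I. \<bar>prob (\<Gamma> (r n) \<inter> \<Gamma> (r m)) - prob (\<Gamma> (r n)) * prob (\<Gamma> (r m))\<bar>)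
    \<le> 4 * K * suminf \<phi> * (\<Sum>n\<in>I. prob (\<Gamma> (r n)))"
proof -
  have \<phi>0: "0 \<le> \<phi> k" for k by (simp add: \<phi>_def)
  have sm: "summable \<phi>" unfolding \<phi>_def using summable_enn2real(2)[OF fin] .
  let ?p = "\<lambda>n. prob (\<Gamma> (r n))"
  let ?d = "\<lambda>n m. \<phi> (nat \<bar>int (r n) - int (r m)\<bar>)"
  have d: "(\<Sum>m\<in>I. ?d n m) \<le> 2 * K * suminf \<phi>" for n
  proof (rule sum_abs_le_suminf_of_fibres[OF \<phi>0 sm \<open>finite I\<close>])
    fix k
    have "{m \<in> I. int (r n) - int (r m) = k} = {m \<in> I. int (r m) = int (r n) - k}" by auto
    then show "real (card {m \<in> I. int (r n) - int (r m) = k}) \<le> K"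
      using card[of "int (r n) - k"] by simp
  qed
  have d_sym: "?d n m = ?d m n" for n m by (simp add: abs_minus_commute)
  have "(\<Sum>n\<in>I. \<Sum>m\<in>I. \<bar>prob (\<Gamma> (r n) \<inter> \<Gamma> (r m)) - ?p n * ?p m\<bar>)
      \<le> (\<Sum>n\<in>I. \<Sum>m\<in>I. (?p n + ?p m) * ?d n m)"
    unfolding \<phi>_def using r by (intro sum_mono phi_mixing_pair_bound ev fin)
  also have "\<dots> = (\<Sum>n\<in>I. \<Sum>m\<in>I. ?p n * ?d n m) + (\<Sum>m\<in>I. \<Sum>n\<in>I. ?p m * ?d n m)"
    by (subst (3) sum.swap) (simp add: distrib_right sum.distrib)
  also have "\<dots> = 2 * (\<Sum>n\<in>I. ?p n * (\<Sum>m\<in>I. ?d n m))"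
    by (simp add: sum_distrib_left d_sym)
  also have "\<dots> \<le> 2 * (\<Sum>n\<in>I. ?p n * (2 * K * suminf \<phi>))"
    using d by (intro mult_left_mono sum_mono) auto
  finally show ?thesis by (simp add: sum_distrib_left sum_distrib_right mult_ac)
qed

text \<open>Each term splits into a pair error and two single-time errors. All are relative errors,
  so one of the factors \<open>p n\<close>, \<open>p m\<close> can be spared when summing the gap
  coefficients.\<close>

lemma (in prob_space) psi_covariance_sum_bound:
  fixes q :: "'i \<Rightarrow> nat \<Rightarrow> nat" and \<Gamma> :: "nat \<Rightarrow> 'a set" and I :: "nat set" and L :: "'i set"
  defines "\<psi> \<equiv> \<lambda>k. enn2real (psi_mixing M \<Gamma> k)"
    and "A \<equiv> \<lambda>n. {\<omega> \<in> space M. \<forall>i\<in>L. \<omega> \<in> \<Gamma> (q i n)}"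
    and "p \<equiv> \<lambda>n. \<Prod>i\<in>L. prob (\<Gamma> (q i n))"
  assumes ev: "\<And>n. 1 \<le> n \<Longrightarrow> \<Gamma> n \<in> events"
    and fin: "(\<Sum>k. psi_mixing M \<Gamma> k) < top"
    and "finite I" "finite L" and q: "\<And>i n. i \<in> L \<Longrightarrow> n \<in> I \<Longrightarrow> 1 \<le> q i n"
    and card: "\<And>i k. i \<in> L \<Longrightarrow> real (card {n \<in> I. int (q i n) = k}) \<le> K"
    and card_diff: "\<And>i j k. i \<in> L \<Longrightarrow> j \<in> L \<Longrightarrow> i \<noteq> j \<Longrightarrow>
      real (card {n \<in> I. int (q i n) - int (q j n) = k}) \<le> K"
    and K: "0 \<le> K"
  shows "(\<Sum>n\<in>I. \<Sum>m\<in>I. prob (A n \<inter> A m) - p n * prob (A m) - p m * prob (A n) + p n * p m)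
    \<le> 12 * (1 + suminf \<psi>) ^ (2 * card L) * (real (card L))\<^sup>2 * K * suminf \<psi> * (\<Sum>n\<in>I. p n)"
proof -
  have \<psi>0: "0 \<le> \<psi> k" for k by (simp add: \<psi>_def)
  have sm: "summable \<psi>" unfolding \<psi>_def using summable_enn2real(2)[OF fin] .
  have \<tau>0: "0 \<le> suminf \<psi>" using sm \<psi>0 by (rule suminf_nonneg)
  have p0: "0 \<le> p n" for n unfolding p_def by (intro prod_nonneg) auto
  have p1: "p n \<le> 1" for n unfolding p_def by (intro prod_le_1) auto
  define C where "C = (1 + suminf \<psi>) ^ (2 * card L)"
  have C0: "0 \<le> C" unfolding C_def using \<tau>0 by simp
  \<comment> \<open>\<open>T n\<close> collects gaps within one time, \<open>D n m\<close> gaps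
    between two times. Only \<open>T\<close> omits \<open>i = j\<close>: there the difference would
    be 0 at every time.\<close>
  define T where "T n = (\<Sum>i\<in>L. \<Sum>j\<in>L. if i = j then 0 else \<psi> (nat \<bar>int (q i n) - int (q j n)\<bar>))" for n
  define D where "D n m = (\<Sum>i\<in>L. \<Sum>j\<in>L. \<psi> (nat \<bar>int (q i n) - int (q j m)\<bar>))" for n m
  have T0: "0 \<le> T n" for n unfolding T_def using \<psi>0 by (intro sum_nonneg) auto
  have D0: "0 \<le> D n m" for n m unfolding D_def using \<psi>0 by (intro sum_nonneg) auto
  have D_sym: "D m n = D n m" for n m
    unfolding D_def by (subst sum.swap) (simp add: abs_minus_commute)
  have single: "\<bar>prob (A n) - p n\<bar> \<le> C * p n * T n" if "n \<in> I" for n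
  proof -
    have "\<bar>prob (A n) - p n\<bar> \<le> (1 + suminf \<psi>) ^ card L * p n * T n"
      unfolding A_def p_def T_def \<psi>_def
      using q that by (intro psi_mixing_product_bound ev fin \<open>finite L\<close>)
    also have "\<dots> \<le> C * p n * T n"
      unfolding C_def using \<tau>0 p0 T0 by (intro mult_right_mono power_increasing) auto
    finally show ?thesis .
  qed
  have pair: "\<bar>prob (A n \<inter> A m) - p n * p m\<bar> \<le> C * (p n * p m) * (T n + T m + 2 * D n m)"
    if "n \<in> I" "m \<in> I" for n m
  proof -
    \<comment> \<open>The disjoint sum keeps the events of the two times apart even if
      \<open>n = m\<close>. Ordered label pairs count each cross gap twice, whence
      \<open>2 * D n m\<close>; the \<open>2 * card L\<close> labels give the exponent in
      \<open>C\<close>.\<close>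
    let ?r = "case_sum (\<lambda>i. q i n) (\<lambda>i. q i m)"
    let ?B = "L <+> L"
    have fB: "finite ?B" using \<open>finite L\<close> by simp
    have 1: "A n \<inter> A m = {\<omega> \<in> space M. \<forall>a\<in>?B. \<omega> \<in> \<Gamma> (?r a)}"
      unfolding A_def by (auto simp: Plus_def ball_Un)
    have 2: "p n * p m = (\<Prod>a\<in>?B. prob (\<Gamma> (?r a)))"
      unfolding p_def using \<open>finite L\<close> by (simp add: prod.Plus)
    have 3: "T n + T m + 2 * D n m =
        (\<Sum>a\<in>?B. \<Sum>b\<in>?B. if a = b then 0 else \<psi> (nat \<bar>int (?r a) - int (?r b)\<bar>))"
      using \<open>finite L\<close> D_sym[of n m]
      by (simp add: sum.Plus sum.distrib T_def D_def cong: if_cong)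
    have 4: "card ?B = 2 * card L" using \<open>finite L\<close> by (simp add: card_Plus)
    show ?thesis
      unfolding 1 2 3 C_def 4[symmetric] \<psi>_def
      using q that by (intro psi_mixing_product_bound ev fin fB) auto
  qed
  have term_le: "prob (A n \<inter> A m) - p n * prob (A m) - p m * prob (A n) + p n * p m
      \<le> 2 * C * (p m * T n + p n * T m + p n * D n m)" if nm: "n \<in> I" "m \<in> I" for n m
  proof -
    have "prob (A n \<inter> A m) - p n * prob (A m) - p m * prob (A n) + p n * p m =
        (prob (A n \<inter> A m) - p n * p m) - p n * (prob (A m) - p m) - p m * (prob (A n) - p n)"
      by (simp add: algebra_simps)
    also have "\<dots> \<le> C * (p n * p m) * (T n + T m + 2 * D n m)
        + p n * (C * p m * T m) + p m * (C * p n * T n)"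
    proof -
      have "- (p n * (prob (A m) - p m)) \<le> p n * (C * p m * T m)"
        using mult_left_mono[OF single[OF nm(2)] p0[of n]] p0[of n]
        by (smt (verit) abs_mult mult_minus_right abs_ge_minus_self abs_of_nonneg)
      moreover have "- (p m * (prob (A n) - p n)) \<le> p m * (C * p n * T n)"
        using mult_left_mono[OF single[OF nm(1)] p0[of m]] p0[of m]
        by (smt (verit) abs_mult mult_minus_right abs_ge_minus_self abs_of_nonneg)
      ultimately show ?thesis using pair[OF nm] by linarith
    qed
    also have "\<dots> = 2 * C * (p n * (p m * T n) + p m * (p n * T m) + p m * (p n * D n m))"
      by (simp add: algebra_simps)
    \<comment> \<open>Since the \<open>p\<close> are at most 1, one is dropped from each product.
      The one kept leaves the other time free for summing \<open>T\<close>, or for summing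
      \<open>D\<close> over \<open>m\<close>.\<close>
    also have "\<dots> \<le> 2 * C * (p m * T n + p n * T m + p n * D n m)"
      using C0 p0 p1 T0 D0 by (intro mult_left_mono add_mono mult_left_le_one_le mult_nonneg_nonneg) auto
    finally show ?thesis .
  qed
  define R where "R = (real (card L))\<^sup>2 * (2 * K * suminf \<psi>)"
  have double: "(\<Sum>i\<in>L. \<Sum>j\<in>L. f i j) \<le> R" if "\<And>i j. i \<in> L \<Longrightarrow> j \<in> L \<Longrightarrow> f i j \<le> 2 * K * suminf \<psi>" for f
  proof -
    have "(\<Sum>i\<in>L. \<Sum>j\<in>L. f i j) \<le> (\<Sum>i\<in>L. \<Sum>j\<in>L. 2 * K * suminf \<psi>)"
      using that by (intro sum_mono) auto
    then show ?thesis by (simp add: R_def power2_eq_square)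
  qed
  have T_sum: "(\<Sum>n\<in>I. T n) \<le> R"
  proof -
    have "(\<Sum>n\<in>I. T n) = (\<Sum>i\<in>L. \<Sum>j\<in>L. \<Sum>n\<in>I. if i = j then 0 else \<psi> (nat \<bar>int (q i n) - int (q j n)\<bar>))"
      unfolding T_def by (subst sum.swap, intro sum.cong refl, rule sum.swap)
    also have "\<dots> \<le> R"
    proof (rule double)
      fix i j assume ij: "i \<in> L" "j \<in> L"
      show "(\<Sum>n\<in>I. if i = j then 0 else \<psi> (nat \<bar>int (q i n) - int (q j n)\<bar>)) \<le> 2 * K * suminf \<psi>"
      proof (cases "i = j")
        case True
        then show ?thesis using K \<tau>0 by simp
      next
        case False
        then show ?thesis
          using sum_abs_le_suminf_of_fibres[OF \<psi>0 sm \<open>finite I\<close> card_diff[OF ij False]] by simp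
      qed
    qed
    finally show ?thesis .
  qed
  \<comment> \<open>With \<open>n\<close> fixed only \<open>q j m\<close> moves, so fibres of a
    single \<open>q j\<close> matter, whereas \<open>T_sum\<close> needs those of
    differences.\<close>
  have D_sum: "(\<Sum>m\<in>I. D n m) \<le> R" for n
  proof -
    have "(\<Sum>m\<in>I. D n m) = (\<Sum>i\<in>L. \<Sum>j\<in>L. \<Sum>m\<in>I. \<psi> (nat \<bar>int (q i n) - int (q j m)\<bar>))"
      unfolding D_def by (subst sum.swap, intro sum.cong refl, rule sum.swap)
    also have "\<dots> \<le> R"
    proof (intro double sum_abs_le_suminf_of_fibres[OF \<psi>0 sm \<open>finite I\<close>])
      fix i j k assume "j \<in> L"
      have "{m \<in> I. int (q i n) - int (q j m) = k} = {m \<in> I. int (q j m) = int (q i n) - k}" by auto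
      then show "real (card {m \<in> I. int (q i n) - int (q j m) = k}) \<le> K"
        using card[OF \<open>j \<in> L\<close>, of "int (q i n) - k"] by simp
    qed
    finally show ?thesis .
  qed
  let ?E = "\<Sum>n\<in>I. p n"
  have E0: "0 \<le> ?E" using p0 by (intro sum_nonneg)
  have "(\<Sum>n\<in>I. \<Sum>m\<in>I. prob (A n \<inter> A m) - p n * prob (A m) - p m * prob (A n) + p n * p m)
      \<le> (\<Sum>n\<in>I. \<Sum>m\<in>I. 2 * C * (p m * T n + p n * T m + p n * D n m))"
    by (intro sum_mono term_le)
  also have "\<dots> = 2 * C * (?E * (\<Sum>n\<in>I. T n) + ?E * (\<Sum>n\<in>I. T n) + (\<Sum>n\<in>I. p n * (\<Sum>m\<in>I. D n m)))"
    by (simp add: sum.distrib sum_distrib_left[symmetric] sum_distrib_right[symmetric] mult.commute)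
  also have "\<dots> \<le> 2 * C * (?E * R + ?E * R + (\<Sum>n\<in>I. p n * R))"
    using C0 E0 T_sum D_sum p0 by (intro mult_left_mono add_mono sum_mono) auto
  also have "\<dots> = 6 * C * ?E * R"
    by (simp only: sum_distrib_right[symmetric]) (simp add: algebra_simps)
  finally show ?thesis unfolding R_def C_def by (simp add: mult_ac)
qed

section \<open>Almost sure convergence from the two mean square bounds\<close>

theorem theorem2p2:
  fixes M :: "'a measure" and \<Gamma> :: "nat \<Rightarrow> 'a set"
    and l :: nat and q :: "nat \<Rightarrow> nat \<Rightarrow> nat" and K :: real
  assumes "prob_space M"
    and "l \<ge> 1"
    and "\<And>n. n \<ge> 1 \<Longrightarrow> \<Gamma> n \<in> sets M"
    and "l = 1 \<Longrightarrow> (\<Sum>k. phi_mixing M \<Gamma> k) < \<infinity>"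
    and "l > 1 \<Longrightarrow> (\<Sum>k. psi_mixing M \<Gamma> k) < \<infinity>"
    and "\<And>i n. i \<in> {1..l} \<Longrightarrow> n \<ge> 1 \<Longrightarrow> q i n \<ge> 1"
    and "K > 0"
    and "\<And>i j (k::int). i \<in> {1..l} \<Longrightarrow> j \<in> {1..l} \<Longrightarrow> i \<noteq> j \<Longrightarrow>
           finite {n. int (q i n) - int (q j n) = k \<or> int (q i n) = k} \<and>
           real (card {n. int (q i n) - int (q j n) = k \<or> int (q i n) = k}) \<le> K"
    and "\<And>k::int. l = 1 \<Longrightarrow>
           finite {n. int (q 1 n) = k} \<and> real (card {n. int (q 1 n) = k}) \<le> K"
    and "filterlim (\<lambda>N. prob_sum M \<Gamma> q l N) at_top sequentially"
  shows "AE \<omega> in M. (\<lambda>N. hit_sum \<Gamma> q l N \<omega> / prob_sum M \<Gamma> q l N) \<longlonglongrightarrow> 1"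
proof -
  interpret prob_space M by fact
  define A where "A n = {\<omega> \<in> space M. \<forall>i\<in>{1..l}. \<omega> \<in> \<Gamma> (q i n)}" for n
  define p where "p n = (\<Prod>i=1..l. prob (\<Gamma> (q i n)))" for n
  have prob_sum_eq: "prob_sum M \<Gamma> q l N = (\<Sum>n=1..N. p n)" for N
    by (simp add: prob_sum_def p_def)
  have hit_sum_eq: "hit_sum \<Gamma> q l N \<omega> = (\<Sum>n=1..N. indicator (A n) \<omega>)" if "\<omega> \<in> space M" for N \<omega>
  proof -
    have "(\<Prod>i\<in>L. indicator (\<Gamma> (q i n)) \<omega> :: real) = (if \<forall>i\<in>L. \<omega> \<in> \<Gamma> (q i n) then 1 else 0)"
      if "finite L" for L n
      using that by induction (auto simp: indicator_def)
    from this[of "{1..l}"] show ?thesis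
      unfolding hit_sum_def A_def using that by (intro sum.cong refl) (simp add: indicator_def)
  qed
  have A: "A n \<in> events" if "1 \<le> n" for n
    unfolding A_def
  proof (rule sets.sets_Collect_finite_All)
    fix i assume "i \<in> {1..l}"
    then have *: "\<Gamma> (q i n) \<in> events" using assms(3,6) that by blast
    then have "{\<omega> \<in> space M. \<omega> \<in> \<Gamma> (q i n)} = \<Gamma> (q i n)" using sets.sets_into_space by blast
    then show "{\<omega> \<in> space M. \<omega> \<in> \<Gamma> (q i n)} \<in> events" using * by simp
  qed simp
  \<comment> \<open>Passes from solutions among all \<open>n\<close> to those up to
    \<open>N\<close>. Finiteness is essential, since \<open>card\<close> of an infinite set is
    0.\<close>
  have card_le: "real (card {n \<in> {1..N}. P n}) \<le> K"
    if "finite {n. Q n}" "real (card {n. Q n}) \<le> K" "\<And>n. P n \<Longrightarrow> Q n" for N P Q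
  proof -
    have "card {n \<in> {1..N}. P n} \<le> card {n. Q n}" using that(1,3) by (intro card_mono) auto
    then show ?thesis using that(2) by linarith
  qed
  obtain C where C: "\<And>N. (\<Sum>n=1..N. \<Sum>m=1..N. prob (A n \<inter> A m) - p n * prob (A m) - p m * prob (A n) + p n * p m)
        \<le> C * (\<Sum>n=1..N. p n)"
  proof (cases "l = 1")
    case True
    show thesis
    proof (rule that)
      fix N
      have An: "A n = \<Gamma> (q 1 n)" if "n \<in> {1..N}" for n
        using assms(3)[of "q 1 n", THEN sets.sets_into_space] assms(6)[of 1 n] that True
        by (auto simp: A_def)
      have pn: "p n = prob (\<Gamma> (q 1 n))" for n using True by (simp add: p_def)
      \<comment> \<open>For a single factor \<open>p n\<close> is the true probability of
        \<open>A n\<close>, so each term reduces to a covariance.\<close>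
      have "(\<Sum>n=1..N. \<Sum>m=1..N. prob (A n \<inter> A m) - p n * prob (A m) - p m * prob (A n) + p n * p m)
          \<le> (\<Sum>n=1..N. \<Sum>m=1..N. \<bar>prob (\<Gamma> (q 1 n) \<inter> \<Gamma> (q 1 m)) - prob (\<Gamma> (q 1 n)) * prob (\<Gamma> (q 1 m))\<bar>)"
        by (intro sum_mono) (simp add: An pn)
      also have "\<dots> \<le> 4 * K * (\<Sum>k. enn2real (phi_mixing M \<Gamma> k)) * (\<Sum>n=1..N. p n)"
        unfolding pn
      proof (rule phi_covariance_sum_bound)
        show "real (card {n \<in> {1..N}. int (q 1 n) = k}) \<le> K" for k
          using assms(9)[OF True, of k] by (intro card_le[of "\<lambda>n. int (q 1 n) = k"]) auto
      qed (use assms(3,4,6) True in auto)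
      finally show "(\<Sum>n=1..N. \<Sum>m=1..N. prob (A n \<inter> A m) - p n * prob (A m) - p m * prob (A n) + p n * p m)
          \<le> 4 * K * (\<Sum>k. enn2real (phi_mixing M \<Gamma> k)) * (\<Sum>n=1..N. p n)" .
    qed
  next
    case False
    then have l: "1 < l" using assms(2) by simp
    show thesis
    proof (rule that, unfold A_def p_def, rule psi_covariance_sum_bound)
      fix N i and k :: int assume i: "i \<in> {1..l}"
      \<comment> \<open>The fibres of \<open>q i\<close> are bounded only jointly with those of a
        difference, so some second label is required; it exists because
        \<open>l > 1\<close>.\<close>
      define j where "j = (if i = 1 then 2 else 1 :: nat)"
      have j: "j \<in> {1..l}" "i \<noteq> j" using l by (auto simp: j_def)
      show "real (card {n \<in> {1..N}. int (q i n) = k}) \<le> K"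
        using assms(8)[OF i j, of k]
        by (intro card_le[of "\<lambda>n. int (q i n) - int (q j n) = k \<or> int (q i n) = k"]) auto
    next
      fix N i j and k :: int assume "i \<in> {1..l}" "j \<in> {1..l}" "i \<noteq> j"
      from assms(8)[OF this, of k]
      show "real (card {n \<in> {1..N}. int (q i n) - int (q j n) = k}) \<le> K"
        by (intro card_le[of "\<lambda>n. int (q i n) - int (q j n) = k \<or> int (q i n) = k"]) auto
    qed (use assms(3,5,6,7) l in auto)
  qed
  have "AE \<omega> in M. (\<lambda>N. (\<Sum>n=1..N. indicator (A n) \<omega>) / (\<Sum>n=1..N. p n)) \<longlonglongrightarrow> 1"
  proof (rule AE_indicator_sum_ratio_tendsto_1[OF A _ _ _ C])
    show "0 \<le> p n" "p n \<le> 1" for n unfolding p_def by (auto intro!: prod_nonneg prod_le_1)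
    show "filterlim (\<lambda>N. \<Sum>n=1..N. p n) at_top sequentially"
      using assms(10) by (simp add: prob_sum_eq)
  qed
  then show ?thesis
    by (rule AE_mp) (auto intro!: AE_I2 simp: prob_sum_eq hit_sum_eq)
qed

end
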